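(* Assume the linear equation $\mathbf{z}=\mathbf{H}\mathbf{y}$ admits at least one exact solution, and suppose that for some $p\in(0,1)$ the $p$-persistent graph $\mathcal{G}_P(p)$ of the random graph process $\langle\mathcal{G}\rangle$ is connected. Let $\mathbf{x}_i(t)$, $i\in\mathrm{V}$, be generated by the projection consensus algorithm $$\mathbf{x}_i(t+1)=\Pi_{\mathcal{A}_i}\Big(\sum_{j=1}^N \mathbf{W}_{ij}(t)\mathbf{x}_j(t)\Big),\qquad i=1,\dots,N,\ t=0,1,2,\dots,$$ from arbitrary fixed (deterministic) initial states $\mathbf{x}(0)=(\mathbf{x}_1^T(0),\dots,\mathbf{x}_N^T(0))^T$. Then: (i) All local estimates converge almost surely to a consensual solution of $\mathbf{z}=\mathbf{H}\mathbf{y}$: $$\mathbb{P}\Big(\lim_{t\to\infty}\mathbf{x}_i(t)=\frac1N\sum_{j=1}^N\Pi_{\mathcal{A}^*}(\mathbf{x}_j(0))\Big)=1\qquad\text{for all } i\in\mathrm{V}.$$ (ii) The mean-squared error converges to zero at an exponential rate: there exist $0<\mu_1<1$ and a constant $c_1>0$ such that for all $t\ge 0$, $$\mathbb{E}\Big[\sum_{i\in\mathrm{V}}\Big\|\mathbf{x}_i(t)-\frac1N\sum_{j=1}^N\Pi_{\mathcal{A}^*}(\mathbf{x}_j(0))\Big\|^2\Big]\le c_1\mu_1^{t}.$$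
   Context: Linear equation: $\mathbf{H}\in\mathbb{R}^{l\times m}$, $\mathbf{z}\in\mathbb{R}^l$, unknown $\mathbf{y}\in\mathbb{R}^m$. The rows are partitioned into $N$ consecutive blocks of sizes $l_1,\dots,l_N$ with $\sum_i l_i=l$; node $i\in\mathrm{V}=\{1,\dots,N\}$ holds the block $\mathbf{z}_i=\mathbf{H}_i\mathbf{y}$, with $\mathbf{H}_i\in\mathbb{R}^{l_i\times m}$, $\mathbf{z}_i\in\mathbb{R}^{l_i}$. Put $\mathcal{A}_i=\{\mathbf{y}\in\mathbb{R}^m:\mathbf{z}_i=\mathbf{H}_i\mathbf{y}\}$ and $\mathcal{A}^*=\{\mathbf{y}\in\mathbb{R}^m:\mathbf{z}=\mathbf{H}\mathbf{y}\}=\bigcap_i\mathcal{A}_i$. $\Pi_\Omega$ is the Euclidean projection onto a closed convex set $\Omega$, and $\|\cdot\|$ is the Euclidean norm. Random graphs: $\langle\mathcal{G}\rangle$ is a random process of undirected graphs $\mathcal{G}(t)=\{\mathrm{V},\mathcal{E}(t)\}$, $t=0,1,2,\dots$ (edges are unordered pairs of distinct nodes). Let $\mathcal{I}_{ij}(t)=1$ if $\{i,j\}\in\mathcal{E}(t)$ and $0$ otherwise, and $\mathcal{I}(t)=(\mathcal{I}_{ij}(t))_{i,j\in\mathrm{V}}$. Standing assumption: $\langle\mathcal{I}(t)\rangle_{t\ge0}$ is $\ast$-mixing, i.e. there is a non-increasing sequence of real numbers $\lambda_t$, $t=0,1,\dots$, with $\lim_{t\to\infty}\lambda_t=0$, such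 that for all $m,s=0,1,2,\dots$, all $\mathsf{A}\in\mathcal{F}_0^m$ and all $\mathsf{B}\in\mathcal{F}_{m+s}^\infty$, $|\mathbb{P}(\mathsf{A}\cap\mathsf{B})-\mathbb{P}(\mathsf{A})\mathbb{P}(\mathsf{B})|\le\lambda_s\mathbb{P}(\mathsf{A})\mathbb{P}(\mathsf{B})$, where $\mathcal{F}_l^k$ is the $\sigma$-algebra generated by $\mathcal{I}(l),\dots,\mathcal{I}(k)$ (with $k=\infty$ allowed). Persistent graph: for $p\in(0,1)$, $\mathcal{G}_P(p)=(\mathrm{V},\mathcal{E}_P(p))$ with $\mathcal{E}_P(p)=\{\{i,j\}:\mathbb{P}(\{i,j\}\in\mathcal{E}(t))\ge p\ \forall t\ge0\}$. Mixing weights: for all $t$, $\mathbf{W}(t)\in\mathbb{R}^{N\times N}$ is $\mathcal{G}(t)$-measurable; there is $0<\eta<1$ (independent of $t$) with $\mathbf{W}_{ii}(t)\ge\eta$ for all $i$, $\mathbf{W}_{ij}(t)=\mathbf{W}_{ji}(t)\ge\eta$ if $\{i,j\}\in\mathcal{E}(t)$, and $\mathbf{W}_{ij}(t)=\mathbf{W}_{ji}(t)=0$ for $i\ne j$ otherwise; and $\mathbf{W}(t)\mathbf{1}_N=\mathbf{1}_N$, $\mathbf{1}_N^T\mathbf{W}(t)=\mathbf{1}_N^T$. *)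

theory Defs
  imports "HOL-Probability.Probability"
begin

text \<open>
  The nodes are the elements of a finite linearly ordered type \<open>'n\<close>, so that
  \<open>N = CARD('n)\<close> and consecutive row blocks make sense; the rows are indexed by a
  finite linearly ordered type \<open>'l\<close>. The number of rows above row \<open>k\<close> is
  \<open>card {..<k}\<close>.
\<close>

definition row_block :: "('n::{finite,linorder} \<Rightarrow> nat) \<Rightarrow> 'n \<Rightarrow> 'l::{finite,linorder} set" where
  "row_block ls i =
     {k. (\<Sum>j | j < i. ls j) \<le> card {..<k} \<and> card {..<k} < (\<Sum>j | j \<le> i. ls j)}"

definition local_solutions ::
  "('n::{finite,linorder} \<Rightarrow> nat) \<Rightarrow> real^'m^'l::{finite,linorder} \<Rightarrow> real^'l::{finite,linorder} \<Rightarrow> 'n \<Rightarrow> (real^'m) set" where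
  "local_solutions ls H z i = {y. \<forall>k \<in> row_block ls i. z $ k = (H *v y) $ k}"

definition solutions :: "real^'m^'l \<Rightarrow> real^'l \<Rightarrow> (real^'m) set" where
  "solutions H z = {y. z = H *v y}"

text \<open>
  A graph on \<open>'n\<close> is given by its edge set, a set of unordered pairs \<open>{i, j}\<close> with
  \<open>i \<noteq> j\<close>.
\<close>

definition simple_edges :: "'n set set \<Rightarrow> bool" where
  "simple_edges F \<longleftrightarrow> (\<forall>e\<in>F. \<exists>i j. i \<noteq> j \<and> e = {i, j})"

definition connected_edges :: "'n set set \<Rightarrow> bool" where
  "connected_edges F \<longleftrightarrow> (\<forall>u v. (u, v) \<in> {(i, j). {i, j} \<in> F}\<^sup>*)"

definition edge_indicator :: "(nat \<Rightarrow> 'w \<Rightarrow> 'n::finite set set) \<Rightarrow> nat \<Rightarrow> 'w \<Rightarrow> real^'n^'n" where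
  "edge_indicator E t \<omega> = (\<chi> i j. if {i, j} \<in> E t \<omega> then 1 else 0)"

definition random_graph_process :: "'w measure \<Rightarrow> (nat \<Rightarrow> 'w \<Rightarrow> 'n::finite set set) \<Rightarrow> bool" where
  "random_graph_process M E \<longleftrightarrow>
     (\<forall>t. \<forall>\<omega>\<in>space M. simple_edges (E t \<omega>)) \<and>
     (\<forall>t. edge_indicator E t \<in> borel_measurable M)"

text \<open>The \<open>\<sigma>\<close>-algebra generated by \<open>X l, \<dots>, X k\<close>, with \<open>k = \<infinity>\<close> allowed.\<close>

definition generated_algebra ::
  "'w measure \<Rightarrow> (nat \<Rightarrow> 'w \<Rightarrow> 'a::topological_space) \<Rightarrow> nat \<Rightarrow> enat \<Rightarrow> 'w measure" where
  "generated_algebra M X l k =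
     sigma (space M) {X t -` B \<inter> space M | t B. l \<le> t \<and> enat t \<le> k \<and> B \<in> sets borel}"

definition star_mixing :: "'w measure \<Rightarrow> (nat \<Rightarrow> 'w \<Rightarrow> 'a::topological_space) \<Rightarrow> bool" where
  "star_mixing M X \<longleftrightarrow>
     (\<exists>lam :: nat \<Rightarrow> real. decseq lam \<and> lam \<longlonglongrightarrow> 0 \<and>
        (\<forall>m s. \<forall>A \<in> sets (generated_algebra M X 0 (enat m)).
           \<forall>B \<in> sets (generated_algebra M X (m + s) \<infinity>).
             \<bar>measure M (A \<inter> B) - measure M A * measure M B\<bar>
               \<le> lam s * measure M A * measure M B))"

definition persistent_edges ::
  "'w measure \<Rightarrow> (nat \<Rightarrow> 'w \<Rightarrow> 'n set set) \<Rightarrow> real \<Rightarrow> 'n set set" where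
  "persistent_edges M E p =
     {{i, j} | i j. i \<noteq> j \<and> (\<forall>t. \<P>(\<omega> in M. {i, j} \<in> E t \<omega>) \<ge> p)}"

definition mixing_weights ::
  "'w measure \<Rightarrow> (nat \<Rightarrow> 'w \<Rightarrow> 'n::finite set set) \<Rightarrow> (nat \<Rightarrow> 'w \<Rightarrow> real^'n^'n) \<Rightarrow> bool" where
  "mixing_weights M E W \<longleftrightarrow>
     (\<forall>t. W t \<in> borel_measurable (generated_algebra M (edge_indicator E) t (enat t))) \<and>
     (\<exists>\<eta>. 0 < \<eta> \<and> \<eta> < 1 \<and>
        (\<forall>t. \<forall>\<omega>\<in>space M.
           (\<forall>i. W t \<omega> $ i $ i \<ge> \<eta>) \<and>
           (\<forall>i j. {i, j} \<in> E t \<omega> \<longrightarrow> W t \<omega> $ i $ j = W t \<omega> $ j $ i \<and> W t \<omega> $ i $ j \<ge> \<eta>) \<and>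
           (\<forall>i j. i \<noteq> j \<and> {i, j} \<notin> E t \<omega> \<longrightarrow> W t \<omega> $ i $ j = 0 \<and> W t \<omega> $ j $ i = 0))) \<and>
     (\<forall>t. \<forall>\<omega>\<in>space M. W t \<omega> *v 1 = 1 \<and> 1 v* W t \<omega> = 1)"

text \<open>
  The states are stacked: \<open>x t \<omega> $ i\<close> is the state of node \<open>i\<close> at time \<open>t\<close>.
\<close>

definition projection_consensus ::
  "'w measure \<Rightarrow> ('n::{finite,linorder} \<Rightarrow> nat) \<Rightarrow> real^'m^'l::{finite,linorder} \<Rightarrow> real^'l::{finite,linorder} \<Rightarrow>
   (nat \<Rightarrow> 'w \<Rightarrow> real^'n::{finite,linorder}^'n::{finite,linorder}) \<Rightarrow> real^'m^'n::{finite,linorder} \<Rightarrow>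
   (nat \<Rightarrow> 'w \<Rightarrow> real^'m^'n::{finite,linorder}) \<Rightarrow> bool" where
  "projection_consensus M ls H z W x0 x \<longleftrightarrow>
     (\<forall>\<omega>\<in>space M. x 0 \<omega> = x0 \<and>
        (\<forall>t i. x (Suc t) \<omega> $ i =
           closest_point (local_solutions ls H z i) (\<Sum>j\<in>UNIV. W t \<omega> $ i $ j *\<^sub>R x t \<omega> $ j)))"

definition consensus_limit :: "real^'m^'l \<Rightarrow> real^'l \<Rightarrow> real^'m^'n \<Rightarrow> real^'m" where
  "consensus_limit H z x0 =
     (1 / real CARD('n)) *\<^sub>R (\<Sum>j\<in>UNIV. closest_point (solutions H z) (x0 $ j))"

end

theory Submission
  imports Defs
begin

text \<open>
  Let \<open>c\<close> be the claimed limit and \<open>V t = (\<Sum>i. (norm (x t $ i - c))\<^sup>2)\<close>. Double stochasticity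
  and the Pythagorean identity for projections onto affine sets show that \<open>V\<close> decreases, and
  that the decrease over a window controls the drift of the states, the residuals of
  the local equations, and the disagreement across every edge seen in the window. Mixing
  turns the last bound into one, in expectation, on the disagreement across every
  persistent edge. The sum of all these disagreements and residuals is a quadratic form;
  it is positive definite on the invariant subspace in which the trajectory moves, because
  the persistent graph is connected and because
  \<open>\<Sum>i. (x t $ i - c)\<close> stays orthogonal to the kernel of \<open>H\<close>. So the expectation of \<open>V\<close>
  contracts by a fixed factor over each window. Exponential decay makes
  \<open>\<Sum>t. V t\<close> integrable, which gives almost sure convergence.
\<close>

section \<open>Energy along a trajectory\<close>

text \<open>The reflection \<open>2 q - y\<close> of a point \<open>y\<close> of \<open>A\<close>
  through the projection \<open>q\<close> lies in \<open>A\<close> again, so the obtuse-angle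
  inequality holds with both signs and becomes an equality.\<close>

lemma closest_point_affine_orthogonal:
  fixes A :: "'a::euclidean_space set"
  assumes "affine A" "closed A" "a \<in> A" "b \<in> A"
  shows "(v - closest_point A v) \<bullet> (a - b) = 0"
proof -
  let ?q = "closest_point A v"
  have q: "?q \<in> A" using assms closest_point_in_set by blast
  have *: "(v - ?q) \<bullet> (y - ?q) = 0" if "y \<in> A" for y
  proof -
    have "2 *\<^sub>R ?q + (-1) *\<^sub>R y \<in> A"
      by (rule mem_affine[OF assms(1) q that]) simp
    then have "(v - ?q) \<bullet> ((2 *\<^sub>R ?q + (-1) *\<^sub>R y) - ?q) \<le> 0"
      using closest_point_dot assms affine_imp_convex by blast
    moreover have "(2 *\<^sub>R ?q + (-1) *\<^sub>R y) - ?q = - (y - ?q)"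
      by (simp add: scaleR_2)
    moreover have "(v - ?q) \<bullet> (y - ?q) \<le> 0"
      using closest_point_dot assms affine_imp_convex that by blast
    ultimately show ?thesis by (metis inner_minus_right neg_le_0_iff_le order_antisym)
  qed
  show ?thesis using *[OF assms(3)] *[OF assms(4)] by (simp add: inner_diff_right)
qed

lemma closest_point_affine_pythagoras:
  fixes A :: "'a::euclidean_space set"
  assumes "affine A" "closed A" "a \<in> A"
  shows "(norm (v - a))\<^sup>2 = (norm (closest_point A v - a))\<^sup>2 + (norm (v - closest_point A v))\<^sup>2"
proof -
  let ?q = "closest_point A v"
  have "(v - ?q) \<bullet> (?q - a) = 0"
    using assms closest_point_affine_orthogonal closest_point_in_set by blast
  moreover have "v - a = (v - ?q) + (?q - a)" by simp
  ultimately show ?thesis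
    by (metis norm_add_Pythagorean orthogonal_def add.commute)
qed

text \<open>Bias-variance decomposition: the cross terms vanish because weighted deviations from the
  weighted mean sum to zero.\<close>

lemma weighted_variance:
  fixes f :: "'n::finite \<Rightarrow> 'a::real_inner"
  assumes "sum w UNIV = 1" and v: "v = (\<Sum>j\<in>UNIV. w j *\<^sub>R f j)"
  shows "(\<Sum>j\<in>UNIV. w j * (norm (f j - c))\<^sup>2) =
    (norm (v - c))\<^sup>2 + (\<Sum>j\<in>UNIV. w j * (norm (f j - v))\<^sup>2)"
proof -
  let ?g = "\<lambda>j. w j * ((f j - v) \<bullet> (v - c))"
  have e: "w j * (norm (f j - c))\<^sup>2 = w j * (norm (f j - v))\<^sup>2 + 2 * ?g j + w j * (norm (v - c))\<^sup>2" for j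
    by (simp add: power2_norm_eq_inner inner_diff_left inner_diff_right inner_commute algebra_simps)
  have "(\<Sum>j\<in>UNIV. w j * ((f j - v) \<bullet> (v - c))) = (\<Sum>j\<in>UNIV. w j *\<^sub>R (f j - v)) \<bullet> (v - c)"
    by (simp add: inner_sum_left)
  also have "(\<Sum>j\<in>UNIV. w j *\<^sub>R (f j - v)) = 0"
    by (simp add: scaleR_diff_right sum_subtractf scaleR_left.sum[symmetric] assms)
  finally have z: "(\<Sum>j\<in>UNIV. w j * ((f j - v) \<bullet> (v - c))) = 0" by simp
  have "(\<Sum>j\<in>UNIV. w j * (norm (f j - c))\<^sup>2) =
    (\<Sum>j\<in>UNIV. w j * (norm (f j - v))\<^sup>2) + 2 * (\<Sum>j\<in>UNIV. w j * ((f j - v) \<bullet> (v - c)))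
     + sum w UNIV * (norm (v - c))\<^sup>2"
    unfolding e by (simp only: sum.distrib sum_distrib_left sum_distrib_right)
  then show ?thesis using z assms by simp
qed

section \<open>Pathwise energy balance and its consequences over a time window\<close>

definition energy :: "'a::real_normed_vector \<Rightarrow> 'a^'n \<Rightarrow> real" where
  "energy c x = (\<Sum>i\<in>UNIV. (norm (x $ i - c))\<^sup>2)"

lemma energy_nonneg: "0 \<le> energy c x"
  unfolding energy_def by (simp add: sum_nonneg)

lemma energy_eq_norm: "energy c x = (norm (x - (\<chi> i. c)))\<^sup>2"
  by (simp add: energy_def norm_vec_def L2_set_def sum_nonneg)

text \<open>A single sample path, with all randomness removed. Lower bounds on off-diagonal weights
  are not part of the setting; they enter lemma by lemma, for the edges present.\<close>

locale consensus_run =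
  fixes A :: "'n::finite \<Rightarrow> 'a::euclidean_space set"
    and W :: "nat \<Rightarrow> real^'n^'n"
    and x :: "nat \<Rightarrow> 'a^'n"
    and \<eta> :: real
  assumes aff: "affine (A i)" and clo: "closed (A i)"
    and eta: "0 < \<eta>" "\<eta> \<le> 1"
    and nonneg: "0 \<le> W t $ i $ j"
    and diag: "\<eta> \<le> W t $ i $ i"
    and row: "(\<Sum>j\<in>UNIV. W t $ i $ j) = 1"
    and col: "(\<Sum>i\<in>UNIV. W t $ i $ j) = 1"
    and step: "x (Suc t) $ i = closest_point (A i) (\<Sum>j\<in>UNIV. W t $ i $ j *\<^sub>R x t $ j)"
begin

definition avg :: "nat \<Rightarrow> 'n \<Rightarrow> 'a" where
  "avg t i = (\<Sum>j\<in>UNIV. W t $ i $ j *\<^sub>R x t $ j)"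

text \<open>Unit column sums spread the energy at time \<open>t\<close> over the rows, unit row sums
  split each row into mean and variance, and Pythagoras splits the mean part at the
  projection.\<close>

lemma energy_step:
  assumes "\<And>i. c \<in> A i"
  shows "energy c (x t) = energy c (x (Suc t)) + (\<Sum>i\<in>UNIV. (norm (avg t i - x (Suc t) $ i))\<^sup>2)
    + (\<Sum>i\<in>UNIV. \<Sum>j\<in>UNIV. W t $ i $ j * (norm (x t $ j - avg t i))\<^sup>2)"
proof -
  have "energy c (x t) = (\<Sum>j\<in>UNIV. (\<Sum>i\<in>UNIV. W t $ i $ j) * (norm (x t $ j - c))\<^sup>2)"
    by (simp add: col energy_def)
  also have "\<dots> = (\<Sum>i\<in>UNIV. \<Sum>j\<in>UNIV. W t $ i $ j * (norm (x t $ j - c))\<^sup>2)"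
    unfolding sum_distrib_right by (rule sum.swap)
  also have "\<dots> = (\<Sum>i\<in>UNIV. (norm (avg t i - c))\<^sup>2 + (\<Sum>j\<in>UNIV. W t $ i $ j * (norm (x t $ j - avg t i))\<^sup>2))"
    by (intro sum.cong refl weighted_variance) (auto simp: row avg_def)
  also have "\<dots> = (\<Sum>i\<in>UNIV. (norm (x (Suc t) $ i - c))\<^sup>2 + (norm (avg t i - x (Suc t) $ i))\<^sup>2
      + (\<Sum>j\<in>UNIV. W t $ i $ j * (norm (x t $ j - avg t i))\<^sup>2))"
    using closest_point_affine_pythagoras[OF aff clo assms] by (simp add: step avg_def)
  finally show ?thesis by (simp add: sum.distrib energy_def)
qed

text \<open>Both loss terms of the balance are sums of nonnegative terms, so each single term is at
  most the total drop.\<close>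

lemma energy_dissipation:
  assumes c: "\<And>i. c \<in> A i"
  shows "energy c (x (Suc t)) \<le> energy c (x t)"
    and "(norm (avg t i - x (Suc t) $ i))\<^sup>2 \<le> energy c (x t) - energy c (x (Suc t))"
    and "W t $ i $ j * (norm (x t $ j - avg t i))\<^sup>2 \<le> energy c (x t) - energy c (x (Suc t))"
proof -
  let ?P = "\<lambda>i. (norm (avg t i - x (Suc t) $ i))\<^sup>2"
  let ?R = "\<lambda>i j. W t $ i $ j * (norm (x t $ j - avg t i))\<^sup>2"
  have R: "0 \<le> ?R i j" for i j using nonneg by simp
  have P0: "0 \<le> sum ?P UNIV" by (simp add: sum_nonneg)
  have R0: "0 \<le> (\<Sum>i\<in>UNIV. \<Sum>j\<in>UNIV. ?R i j)" by (intro sum_nonneg R)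
  have P1: "?P i \<le> sum ?P UNIV" by (rule member_le_sum) auto
  have "?R i j \<le> (\<Sum>j\<in>UNIV. ?R i j)" by (rule member_le_sum) (use R in auto)
  also have "\<dots> \<le> (\<Sum>i\<in>UNIV. \<Sum>j\<in>UNIV. ?R i j)"
    by (rule member_le_sum) (use R in \<open>auto intro: sum_nonneg\<close>)
  finally have R1: "?R i j \<le> (\<Sum>i\<in>UNIV. \<Sum>j\<in>UNIV. ?R i j)" .
  show "energy c (x (Suc t)) \<le> energy c (x t)" "?P i \<le> energy c (x t) - energy c (x (Suc t))"
    "?R i j \<le> energy c (x t) - energy c (x (Suc t))"
    using energy_step[OF c, of t] P0 R0 P1 R1 by linarith+
qed

lemma energy_antimono:
  assumes "\<And>i. c \<in> A i" "s \<le> t"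
  shows "energy c (x t) \<le> energy c (x s)"
  using lift_Suc_antimono_le[of "\<lambda>t. energy c (x t)", OF energy_dissipation(1)] assms by blast

text \<open>By monotonicity the loss at one step is at most the loss over any window containing it;
  the lower bound \<open>\<eta>\<close> then removes the weight.\<close>

lemma norm_avg_diff:
  assumes c: "\<And>i. c \<in> A i" and w: "\<eta> \<le> W s $ i $ j" and ts: "t \<le> s" "s < u"
  shows "norm (x s $ j - avg s i) \<le> sqrt ((energy c (x t) - energy c (x u)) / \<eta>)"
proof -
  have "\<eta> * (norm (x s $ j - avg s i))\<^sup>2 \<le> W s $ i $ j * (norm (x s $ j - avg s i))\<^sup>2"
    using w by (simp add: mult_right_mono)
  also have "\<dots> \<le> energy c (x s) - energy c (x (Suc s))" by (rule energy_dissipation(3)[OF c])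
  also have "\<dots> \<le> energy c (x t) - energy c (x u)"
    using energy_antimono[OF c, of t s] energy_antimono[OF c, of "Suc s" u] ts by auto
  finally have "(norm (x s $ j - avg s i))\<^sup>2 \<le> (energy c (x t) - energy c (x u)) / \<eta>"
    using eta by (simp add: pos_le_divide_eq mult.commute)
  then show ?thesis by (rule real_le_rsqrt)
qed

text \<open>The move is split at \<open>avg s i\<close>: the diagonal weight controls the averaging
  part, the projection loss the rest.\<close>

lemma norm_step_diff:
  assumes c: "\<And>i. c \<in> A i" and ts: "t \<le> s" "s < u"
  shows "norm (x s $ i - x (Suc s) $ i) \<le> 2 * sqrt ((energy c (x t) - energy c (x u)) / \<eta>)"
proof -
  let ?D = "energy c (x t) - energy c (x u)"
  have "(norm (avg s i - x (Suc s) $ i))\<^sup>2 \<le> energy c (x s) - energy c (x (Suc s))"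
    by (rule energy_dissipation(2)[OF c])
  also have "\<dots> \<le> ?D"
    using energy_antimono[OF c, of t s] energy_antimono[OF c, of "Suc s" u] ts by auto
  \<comment> \<open>Since \<open>\<eta> \<le> 1\<close>, the projection part fits under the same
    bound as the averaging part.\<close>
  also have "\<dots> \<le> ?D / \<eta>"
    using eta energy_antimono[OF c, of t u] ts
    by (simp add: pos_le_divide_eq mult_left_le)
  finally have "norm (avg s i - x (Suc s) $ i) \<le> sqrt (?D / \<eta>)" by (rule real_le_rsqrt)
  moreover have "norm (x s $ i - avg s i) \<le> sqrt (?D / \<eta>)"
    by (rule norm_avg_diff[OF c diag ts])
  ultimately show ?thesis
    using norm_triangle_ineq[of "x s $ i - avg s i" "avg s i - x (Suc s) $ i"] by simp
qed

lemma norm_drift: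
  assumes c: "\<And>i. c \<in> A i" and "t + k \<le> u"
  shows "norm (x t $ i - x (t + k) $ i) \<le> 2 * real k * sqrt ((energy c (x t) - energy c (x u)) / \<eta>)"
  using assms(2)
proof (induction k)
  case (Suc k)
  let ?r = "sqrt ((energy c (x t) - energy c (x u)) / \<eta>)"
  have "norm (x (t + k) $ i - x (Suc (t + k)) $ i) \<le> 2 * ?r"
    using Suc.prems by (intro norm_step_diff c) auto
  moreover have "norm (x t $ i - x (t + k) $ i) \<le> 2 * real k * ?r" using Suc by simp
  ultimately show ?case
    using norm_triangle_ineq[of "x t $ i - x (t + k) $ i" "x (t + k) $ i - x (Suc (t + k)) $ i"]
    by (simp add: algebra_simps)
qed simp

text \<open>An edge seen only at time \<open>t + k\<close> still controls the disagreement at time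
  \<open>t\<close>, because both states drift little in between. The pieces add up to
  \<open>4 * k + 2\<close>, rounded up to \<open>4 * Suc k\<close>.\<close>

lemma norm_edge_diff:
  assumes c: "\<And>i. c \<in> A i" and w: "\<eta> \<le> W (t + k) $ i $ j"
  shows "(norm (x t $ i - x t $ j))\<^sup>2 \<le>
    (4 * real (Suc k))\<^sup>2 * ((energy c (x t) - energy c (x (t + Suc k))) / \<eta>)"
proof -
  let ?D = "(energy c (x t) - energy c (x (t + Suc k))) / \<eta>"
  let ?s = "t + k"
  have D: "0 \<le> ?D" using energy_antimono[OF c, of t "t + Suc k"] eta by simp
  have "norm (x ?s $ i - avg ?s i) \<le> sqrt ?D" by (rule norm_avg_diff[OF c diag]) auto
  moreover have "norm (x ?s $ j - avg ?s i) \<le> sqrt ?D" by (rule norm_avg_diff[OF c w]) auto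
  moreover have "norm (x t $ i - x ?s $ i) \<le> 2 * real k * sqrt ?D" by (rule norm_drift[OF c]) auto
  moreover have "norm (x t $ j - x ?s $ j) \<le> 2 * real k * sqrt ?D" by (rule norm_drift[OF c]) auto
  moreover have "x t $ i - x t $ j = (x t $ i - x ?s $ i) + (x ?s $ i - avg ?s i)
      - (x ?s $ j - avg ?s i) - (x t $ j - x ?s $ j)" by simp
  ultimately have "norm (x t $ i - x t $ j)
      \<le> 2 * real k * sqrt ?D + sqrt ?D + sqrt ?D + 2 * real k * sqrt ?D"
    by (smt (verit) norm_triangle_ineq norm_triangle_ineq4)
  also have "\<dots> \<le> 4 * real (Suc k) * sqrt ?D" using D by (simp add: algebra_simps)
  finally have "(norm (x t $ i - x t $ j))\<^sup>2 \<le> (4 * real (Suc k) * sqrt ?D)\<^sup>2"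
    by (intro power_mono) auto
  then show ?thesis unfolding power_mult_distrib using D by simp
qed

text \<open>The drop of one step is enlarged to the drop over \<open>Suc k\<close> steps, so that it
  can be added to edge bounds for the same window.\<close>

lemma norm_residual:
  assumes c: "\<And>i. c \<in> A i"
  shows "(norm (x t $ i - x (Suc t) $ i))\<^sup>2 \<le>
    4 * ((energy c (x t) - energy c (x (t + Suc k))) / \<eta>)"
proof -
  let ?D = "(energy c (x t) - energy c (x (t + Suc k))) / \<eta>"
  have D: "0 \<le> ?D" using energy_antimono[OF c, of t "t + Suc k"] eta by simp
  have "norm (x t $ i - x (Suc t) $ i) \<le> 2 * sqrt ?D" by (rule norm_step_diff[OF c]) auto
  then have "(norm (x t $ i - x (Suc t) $ i))\<^sup>2 \<le> (2 * sqrt ?D)\<^sup>2" by (intro power_mono) auto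
  then show ?thesis unfolding power_mult_distrib using D by simp
qed

text \<open>\<open>y - c\<close> is a direction of every \<open>A i\<close>, so projections remove
  only components orthogonal to it, and unit column sums preserve the total under averaging.\<close>

lemma sum_inner_invariant:
  assumes c: "\<And>i. c \<in> A i" and y: "\<And>i. y \<in> A i"
  shows "(\<Sum>i\<in>UNIV. x t $ i \<bullet> (y - c)) = (\<Sum>i\<in>UNIV. x 0 $ i \<bullet> (y - c))"
proof (induction t)
  case (Suc t)
  have "(\<Sum>i\<in>UNIV. x (Suc t) $ i \<bullet> (y - c)) = (\<Sum>i\<in>UNIV. avg t i \<bullet> (y - c))"
    using closest_point_affine_orthogonal[OF aff clo y c]
    by (intro sum.cong) (auto simp: step avg_def inner_diff_left)
  also have "\<dots> = (\<Sum>i\<in>UNIV. \<Sum>j\<in>UNIV. W t $ i $ j * (x t $ j \<bullet> (y - c)))"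
    by (simp add: avg_def inner_sum_left)
  also have "\<dots> = (\<Sum>j\<in>UNIV. (\<Sum>i\<in>UNIV. W t $ i $ j) * (x t $ j \<bullet> (y - c)))"
    unfolding sum_distrib_right by (rule sum.swap)
  finally show ?case using Suc by (simp add: col)
qed simp

end

section \<open>Linear equations\<close>

text \<open>A continuous positive function has a positive minimum on the compact unit sphere of
  \<open>S\<close>; homogeneity of degree two carries the bound to all of \<open>S\<close>.\<close>

lemma quadratic_lower_bound:
  fixes q :: "'a::euclidean_space \<Rightarrow> real"
  assumes "closed S" "continuous_on UNIV q"
    and S: "\<And>r v. v \<in> S \<Longrightarrow> r *\<^sub>R v \<in> S"
    and q: "\<And>r v. q (r *\<^sub>R v) = r\<^sup>2 * q v"
    and pos: "\<And>v. v \<in> S \<Longrightarrow> v \<noteq> 0 \<Longrightarrow> 0 < q v"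
  obtains \<kappa> where "0 < \<kappa>" "\<And>v. v \<in> S \<Longrightarrow> \<kappa> * (norm v)\<^sup>2 \<le> q v"
proof -
  let ?T = "S \<inter> sphere 0 1"
  have q0: "q 0 = 0" using q[of 0 0] by simp
  have T: "(1 / norm v) *\<^sub>R v \<in> ?T" if "v \<in> S" "v \<noteq> 0" for v
    using S that by (auto simp: dist_norm)
  have cT: "compact ?T" using assms(1) by (simp add: closed_Int_compact)
  obtain \<kappa> where k: "0 < \<kappa>" "\<And>v. v \<in> ?T \<Longrightarrow> \<kappa> \<le> q v"
  proof (cases "?T = {}")
    case True
    \<comment> \<open>Here \<open>S\<close> contains no nonzero vector, and any positive constant
      serves.\<close>
    then show ?thesis using that[of 1] by auto
  next
    case False
    then obtain u where "u \<in> ?T" "\<And>v. v \<in> ?T \<Longrightarrow> q u \<le> q v"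
      using continuous_attains_inf[OF cT _ continuous_on_subset[OF assms(2)]] by blast
    moreover from this have "0 < q u" by (intro pos) auto
    ultimately show ?thesis using that by blast
  qed
  show ?thesis
  proof
    show "0 < \<kappa>" by fact
    fix v assume v: "v \<in> S"
    show "\<kappa> * (norm v)\<^sup>2 \<le> q v"
    proof (cases "v = 0")
      case False
      then show ?thesis using k(2)[OF T[OF v False]] q[of "1 / norm v" v]
        by (simp add: power_divide pos_le_divide_eq)
    qed (simp add: q0)
  qed
qed

text \<open>The owner of row \<open>k\<close> is the first node whose cumulative block length
  exceeds the number of rows above \<open>k\<close>; the total length guarantees that there is
  one.\<close>

lemma row_block_cover:
  fixes ls :: "'n::{finite,linorder} \<Rightarrow> nat" and k :: "'l::{finite,linorder}"
  assumes "(\<Sum>i\<in>UNIV. ls i) = CARD('l)"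
  obtains i where "k \<in> row_block ls i"
proof -
  let ?f = "\<lambda>i. \<Sum>j | j \<le> i. ls j"
  let ?I = "{i. card {..<k} < ?f i}"
  have "{j. j \<le> Max (UNIV :: 'n set)} = UNIV" by auto
  moreover have "card {..<k} < CARD('l)" by (rule psubset_card_mono) auto
  ultimately have "Max UNIV \<in> ?I" using assms by simp
  then have ne: "?I \<noteq> {}" by blast
  define i where "i = Min ?I"
  have i: "i \<in> ?I" unfolding i_def by (rule Min_in) (use ne in auto)
  have "(\<Sum>j | j < i. ls j) \<le> card {..<k}"
  proof (cases "{j. j < i} = {}")
    case False
    \<comment> \<open>The predecessor of \<open>i\<close> fails the test by minimality, and its
      cumulative length is exactly the sum over the nodes strictly below \<open>i\<close>.\<close>
    define i' where "i' = Max {j. j < i}"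
    have i': "i' < i" using Max_in[of "{j. j < i}"] False by (auto simp: i'_def)
    have "{j. j < i} = {j. j \<le> i'}" using i' by (auto simp: i'_def)
    moreover have "i' \<notin> ?I"
    proof
      assume "i' \<in> ?I"
      then have "i \<le> i'" unfolding i_def by (intro Min_le) auto
      then show False using i' by simp
    qed
    ultimately show ?thesis by simp
  qed (simp only: sum.empty)
  then show ?thesis using that[of i] i by (auto simp: row_block_def)
qed

lemma Inter_local_solutions:
  fixes ls :: "'n::{finite,linorder} \<Rightarrow> nat" and z :: "real^'l::{finite,linorder}"
  assumes "(\<Sum>i\<in>UNIV. ls i) = CARD('l)"
  shows "(\<forall>i. y \<in> local_solutions ls H z i) \<longleftrightarrow> y \<in> solutions H z"
proof
  assume *: "\<forall>i. y \<in> local_solutions ls H z i"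
  have "z $ k = (H *v y) $ k" for k
    using row_block_cover[OF assms, of k] * unfolding local_solutions_def by blast
  then show "y \<in> solutions H z" by (simp add: solutions_def vec_eq_iff)
qed (auto simp: solutions_def local_solutions_def)

section \<open>Solution sets as closed affine sets, and the claimed limit among them\<close>

lemma affine_local_solutions: "affine (local_solutions ls H z i)"
  unfolding affine_def
proof (intro ballI allI impI)
  fix y y' and u v :: real
  assume y: "y \<in> local_solutions ls H z i" "y' \<in> local_solutions ls H z i" and uv: "u + v = 1"
  have "z $ k = (H *v (u *\<^sub>R y + v *\<^sub>R y')) $ k" if k: "k \<in> row_block ls i" for k
  proof -
    have e: "(H *v y) $ k = z $ k" "(H *v y') $ k = z $ k"
      using y k by (simp_all add: local_solutions_def)
    have "(H *v (u *\<^sub>R y + v *\<^sub>R y')) $ k = u * z $ k + v * z $ k"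
      by (simp add: matrix_vector_right_distrib matrix_vector_mult_scaleR e)
    also have "\<dots> = (u + v) * z $ k" by (rule distrib_right[symmetric])
    finally show ?thesis using uv by simp
  qed
  then show "u *\<^sub>R y + v *\<^sub>R y' \<in> local_solutions ls H z i" by (simp add: local_solutions_def)
qed

lemma closed_local_solutions: "closed (local_solutions ls H z i)"
proof -
  have "local_solutions ls H z i = (\<Inter>k\<in>row_block ls i. {y. z $ k = (H *v y) $ k})"
    by (auto simp: local_solutions_def)
  moreover have "closed {y. z $ k = (H *v y) $ k}" for k
    by (intro closed_Collect_eq continuous_intros)
  ultimately show ?thesis by auto
qed

lemma affine_solutions: "affine (solutions H z)"
proof -
  have "z = u *\<^sub>R z + v *\<^sub>R z" if "u + v = 1" for u v :: real
    using that by (metis scaleR_add_left scaleR_one)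
  then show ?thesis
    by (auto simp: affine_def solutions_def matrix_vector_right_distrib matrix_vector_mult_scaleR)
qed

lemma closed_solutions: "closed (solutions H z)"
  unfolding solutions_def by (intro closed_Collect_eq continuous_intros)

lemma consensus_limit_solution:
  fixes x0 :: "real^'m^'n"
  assumes "solutions H z \<noteq> {}"
  shows "consensus_limit H z x0 \<in> solutions H z"
proof -
  have p: "closest_point (solutions H z) v \<in> solutions H z" for v
    by (rule closest_point_in_set[OF closed_solutions assms])
  show ?thesis unfolding consensus_limit_def scaleR_sum_right
    by (rule convex_sum) (auto simp: affine_imp_convex affine_solutions p)
qed

text \<open>Replacing the initial states by their projections leaves inner products with solution
  directions unchanged, and the projections sum to \<open>CARD('n)\<close> times \<open>c\<close>.
  This fixes the value of the conserved quantity and thereby singles out \<open>c\<close> among the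
  solutions.\<close>

lemma consensus_limit_orthogonal:
  fixes x0 :: "real^'m^'n"
  assumes "y \<in> solutions H z"
  defines "c \<equiv> consensus_limit H z x0"
  shows "(\<Sum>i\<in>UNIV. (x0 $ i - c) \<bullet> (y - c)) = 0"
proof -
  let ?P = "closest_point (solutions H z)"
  have c: "c \<in> solutions H z" using consensus_limit_solution assms by blast
  have "(\<Sum>i\<in>UNIV. (x0 $ i - c) \<bullet> (y - c)) = (\<Sum>i\<in>UNIV. (?P (x0 $ i) - c) \<bullet> (y - c))"
    using closest_point_affine_orthogonal[OF affine_solutions closed_solutions assms(1) c]
    by (intro sum.cong) (auto simp: inner_diff_left)
  also have "\<dots> = ((\<Sum>i\<in>UNIV. ?P (x0 $ i)) - real CARD('n) *\<^sub>R c) \<bullet> (y - c)"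
    by (simp add: inner_sum_left sum_subtractf sum_constant_scaleR inner_diff_left)
  also have "(\<Sum>i\<in>UNIV. ?P (x0 $ i)) - real CARD('n) *\<^sub>R c = 0"
    by (simp add: c_def consensus_limit_def)
  finally show ?thesis by simp
qed

text \<open>Meant for deviations from a solution, hence the homogeneous residuals. Ordered pairs let
  connectivity be expressed as \<open>F\<^sup>*\<close>; a symmetric \<open>F\<close> counts every
  undirected edge twice.\<close>

definition defect ::
  "('n \<times> 'n) set \<Rightarrow> ('n \<Rightarrow> 'l set) \<Rightarrow> real^'m^'l \<Rightarrow> real^'m^'n \<Rightarrow> real" where
  "defect F R H v = (\<Sum>(i, j)\<in>F. (norm (v $ i - v $ j))\<^sup>2)
     + (\<Sum>i\<in>UNIV. \<Sum>k\<in>R i. ((H *v (v $ i)) $ k)\<^sup>2)"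

text \<open>If the form vanishes, connectivity makes all components equal, and the rows of all nodes
  together put the common value into the kernel of \<open>H\<close>. The orthogonality condition,
  tested with that value, makes it zero.\<close>

lemma defect_lower_bound:
  fixes F :: "('n::finite \<times> 'n) set" and H :: "real^'m^'l"
  assumes conn: "\<And>i j. (i, j) \<in> F\<^sup>*" and cover: "\<And>k. \<exists>i. k \<in> R i"
  obtains \<kappa> where "0 < \<kappa>"
    "\<And>v :: real^'m^'n. (\<And>u. H *v u = 0 \<Longrightarrow> (\<Sum>i\<in>UNIV. v $ i \<bullet> u) = 0) \<Longrightarrow>
      \<kappa> * (norm v)\<^sup>2 \<le> defect F R H v"
proof -
  define S where "S = (\<Inter>u\<in>{u. H *v u = 0}. {v :: real^'m^'n. (\<Sum>i\<in>UNIV. v $ i \<bullet> u) = 0})"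
  have "closed S" unfolding S_def
    by (intro closed_INT ballI closed_Collect_eq continuous_intros)
  moreover have "continuous_on UNIV (defect F R H)"
    unfolding defect_def case_prod_beta matrix_vector_mult_def
    by (simp only: vec_lambda_beta) (intro continuous_intros)
  moreover have "r *\<^sub>R v \<in> S" if "v \<in> S" for r v
    using that by (auto simp: S_def simp flip: sum_distrib_left)
  moreover have "defect F R H (r *\<^sub>R v) = r\<^sup>2 * defect F R H v" for r v
  proof -
    have "norm ((r *\<^sub>R v) $ i - (r *\<^sub>R v) $ j) = \<bar>r\<bar> * norm (v $ i - v $ j)" for i j
      by (simp flip: scaleR_diff_right)
    then show ?thesis
      by (simp add: defect_def matrix_vector_mult_scaleR power_mult_distrib sum_distrib_left
          distrib_left case_prod_beta)
  qed
  moreover have "0 < defect F R H v" if vS: "v \<in> S" and v0: "v \<noteq> 0" for v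
  proof (rule ccontr)
    assume "\<not> 0 < defect F R H v"
    moreover have a: "0 \<le> (\<Sum>(i, j)\<in>F. (norm (v $ i - v $ j))\<^sup>2)"
      by (auto intro: sum_nonneg)
    moreover have b: "0 \<le> (\<Sum>i\<in>UNIV. \<Sum>k\<in>R i. ((H *v (v $ i)) $ k)\<^sup>2)"
      by (intro sum_nonneg) auto
    ultimately have "(\<Sum>(i, j)\<in>F. (norm (v $ i - v $ j))\<^sup>2) = 0"
      and r: "(\<Sum>i\<in>UNIV. \<Sum>k\<in>R i. ((H *v (v $ i)) $ k)\<^sup>2) = 0"
      unfolding defect_def by linarith+
    then have e: "v $ i = v $ j" if "(i, j) \<in> F" for i j
      using that by (auto simp: sum_nonneg_eq_0_iff case_prod_beta)
    have eq: "v $ i = v $ j" for i j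
      using conn[of i j] by (induction rule: rtrancl_induct) (use e in auto)
    obtain i0 :: 'n where True by simp
    have res: "(H *v (v $ i)) $ k = 0" if "k \<in> R i" for i k
      using r that by (auto simp: sum_nonneg_eq_0_iff sum_nonneg)
    have "H *v (v $ i0) = 0"
    proof (simp add: vec_eq_iff, intro allI)
      fix k
      obtain i where "k \<in> R i" using cover by blast
      then show "(H *v (v $ i0)) $ k = 0" using res eq by metis
    qed
    then have "(\<Sum>i\<in>UNIV. v $ i \<bullet> v $ i0) = 0" using vS by (auto simp: S_def)
    then have "(\<Sum>i\<in>(UNIV::'n set). v $ i0 \<bullet> v $ i0) = 0" using eq by (metis (no_types, lifting) sum.cong)
    then have "v $ i0 = 0" by simp
    then show False using eq v0 by (metis vec_eq_iff zero_index)
  qed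
  ultimately obtain \<kappa> where "0 < \<kappa>" "\<And>v. v \<in> S \<Longrightarrow> \<kappa> * (norm v)\<^sup>2 \<le> defect F R H v"
    using quadratic_lower_bound[of S "defect F R H"] by blast
  then show ?thesis using that unfolding S_def by blast
qed

section \<open>Expectations under mixing\<close>

lemma generated_algebra_space [simp]: "space (generated_algebra M X l k) = space M"
  unfolding generated_algebra_def by (intro space_measure_of) auto

lemma generated_algebra_sets:
  "sets (generated_algebra M X l k) =
    sigma_sets (space M) {X t -` B \<inter> space M | t B. l \<le> t \<and> enat t \<le> k \<and> B \<in> sets borel}"
  unfolding generated_algebra_def by (intro sets_measure_of) auto

lemma sets_generated_algebra_mono:
  assumes "l' \<le> l" "k \<le> k'"
  shows "sets (generated_algebra M X l k) \<subseteq> sets (generated_algebra M X l' k')"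
  unfolding generated_algebra_sets
proof (rule sigma_sets_mono', rule Collect_mono, intro impI, elim exE conjE)
  show "\<exists>t B. A = X t -` B \<inter> space M \<and> l' \<le> t \<and> enat t \<le> k' \<and> B \<in> sets borel"
    if "A = X t -` B \<inter> space M" "l \<le> t" "enat t \<le> k" "B \<in> sets borel" for A t B
    using that order_trans[OF assms(1) that(2)] order_trans[OF that(3) assms(2)]
    by (intro exI[of _ t] exI[of _ B]) simp
qed

lemma subalgebra_generated_algebra:
  assumes "\<And>t. X t \<in> borel_measurable M"
  shows "subalgebra M (generated_algebra M X l k)"
  unfolding subalgebra_def generated_algebra_sets
  using assms by (auto intro!: sets.sigma_sets_subset dest: measurable_sets)

lemma vimage_generated_algebra:
  assumes "l \<le> t" "enat t \<le> k" "B \<in> sets borel"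
  shows "X t -` B \<inter> space M \<in> sets (generated_algebra M X l k)"
  unfolding generated_algebra_sets using assms by (intro sigma_sets.Basic) auto

text \<open>The inequality for events, assumed in \<open>low\<close>, passes to multiples, sums and
  increasing limits. Working with extended nonnegative values postpones integrability to the real
  version.\<close>

lemma nn_integral_indicator_lower:
  assumes G: "subalgebra M G" and B: "B \<in> sets M"
    and low: "\<And>A. A \<in> sets G \<Longrightarrow> k * emeasure M A \<le> emeasure M (A \<inter> B)"
    and u: "u \<in> borel_measurable G"
  shows "k * (\<integral>\<^sup>+\<omega>. u \<omega> \<partial>M) \<le> (\<integral>\<^sup>+\<omega>. u \<omega> * indicator B \<omega> \<partial>M)"
  using u
proof (induction rule: borel_measurable_induct)
  case (cong f g)
  have "space G = space M" using G by (simp add: subalgebra_def)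
  then have "(\<integral>\<^sup>+\<omega>. f \<omega> \<partial>M) = (\<integral>\<^sup>+\<omega>. g \<omega> \<partial>M)"
    "(\<integral>\<^sup>+\<omega>. f \<omega> * indicator B \<omega> \<partial>M) = (\<integral>\<^sup>+\<omega>. g \<omega> * indicator B \<omega> \<partial>M)"
    using cong by (auto intro!: nn_integral_cong)
  then show ?case using cong by simp
next
  case (set A)
  have "A \<in> sets M" using set G by (auto simp: subalgebra_def)
  then show ?case using low[OF set] B by (simp flip: indicator_inter_arith)
next
  case (mult u a)
  note [measurable] = B measurable_from_subalg[OF G mult(2)]
  have "k * (\<integral>\<^sup>+\<omega>. a * u \<omega> \<partial>M) = a * (k * (\<integral>\<^sup>+\<omega>. u \<omega> \<partial>M))"
    by (simp add: nn_integral_cmult mult_ac)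
  also have "\<dots> \<le> a * (\<integral>\<^sup>+\<omega>. u \<omega> * indicator B \<omega> \<partial>M)"
    using mult.IH by (rule mult_left_mono) simp
  also have "\<dots> = (\<integral>\<^sup>+\<omega>. a * u \<omega> * indicator B \<omega> \<partial>M)"
    by (simp add: nn_integral_cmult mult.assoc)
  finally show ?case .
next
  case (add u v)
  note [measurable] = B measurable_from_subalg[OF G \<open>u \<in> borel_measurable G\<close>]
    measurable_from_subalg[OF G \<open>v \<in> borel_measurable G\<close>]
  show ?case using add.IH
    by (simp add: nn_integral_add distrib_left distrib_right add_mono)
next
  case (seq U)
  note [measurable] = B measurable_from_subalg[OF G seq(1)]
  have "k * (\<integral>\<^sup>+\<omega>. (SUP i. U i) \<omega> \<partial>M) = (SUP i. k * (\<integral>\<^sup>+\<omega>. U i \<omega> \<partial>M))"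
    using seq by (simp add: nn_integral_monotone_convergence_SUP SUP_mult_left_ennreal image_comp)
  also have "\<dots> \<le> (SUP i. (\<integral>\<^sup>+\<omega>. U i \<omega> * indicator B \<omega> \<partial>M))"
    by (rule SUP_mono) (rule bexI, rule seq.IH, simp)
  also have "\<dots> \<le> (\<integral>\<^sup>+\<omega>. (SUP i. U i) \<omega> * indicator B \<omega> \<partial>M)"
    by (intro SUP_least nn_integral_mono mult_right_mono) (auto intro: SUP_upper)
  finally show ?case .
qed

lemma integral_indicator_lower:
  fixes f :: "'w \<Rightarrow> real"
  assumes M: "finite_measure M" and G: "subalgebra M G" and B: "B \<in> sets M" and k: "0 \<le> k"
    and low: "\<And>A. A \<in> sets G \<Longrightarrow> k * measure M A \<le> measure M (A \<inter> B)"
    and f: "f \<in> borel_measurable G" and f0: "\<And>\<omega>. 0 \<le> f \<omega>" and int: "integrable M f"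
  shows "k * (LINT \<omega>|M. f \<omega>) \<le> (LINT \<omega>|M. f \<omega> * indicator B \<omega>)"
proof -
  interpret finite_measure M by (rule M)
  have int2: "integrable M (\<lambda>\<omega>. f \<omega> * indicator B \<omega>)"
    using B int by (rule integrable_real_mult_indicator)
  have "ennreal k * (\<integral>\<^sup>+\<omega>. ennreal (f \<omega>) \<partial>M) \<le> (\<integral>\<^sup>+\<omega>. ennreal (f \<omega>) * indicator B \<omega> \<partial>M)"
  proof (rule nn_integral_indicator_lower[OF G B])
    fix A assume "A \<in> sets G"
    then show "ennreal k * emeasure M A \<le> emeasure M (A \<inter> B)"
      using low k by (simp add: emeasure_eq_measure ennreal_mult''[symmetric] ennreal_leI)
  qed (use f in measurable)
  also have "\<dots> = (\<integral>\<^sup>+\<omega>. ennreal (f \<omega> * indicator B \<omega>) \<partial>M)"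
    by (intro nn_integral_cong) (auto split: split_indicator)
  finally show ?thesis
    using f0 int int2 k
    by (simp add: nn_integral_eq_integral Bochner_Integration.integral_nonneg ennreal_mult''[symmetric])
qed

lemma periodic_contraction_exponential:
  fixes a :: "nat \<Rightarrow> real"
  assumes nn: "\<And>t. 0 \<le> a t" and dec: "\<And>t. a (Suc t) \<le> a t"
    and T: "0 < T" and r: "\<rho> < 1" and con: "\<And>t. a (t + T) \<le> \<rho> * a t"
  obtains \<mu> c where "0 < \<mu>" "\<mu> < 1" "0 < c" "\<And>t. a t \<le> c * \<mu> ^ t"
proof -
  \<comment> \<open>The given factor may be zero or negative; raising it to at least
    \<open>1/2\<close> makes its root positive.\<close>
  define \<sigma> where "\<sigma> = max \<rho> (1/2)"
  have s: "0 < \<sigma>" "\<sigma> < 1" using r by (auto simp: \<sigma>_def)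
  have con': "a (t + T) \<le> \<sigma> * a t" for t
    using con[of t] mult_right_mono[OF _ nn[of t], of \<rho> \<sigma>] by (simp add: \<sigma>_def)
  define \<mu> where "\<mu> = root T \<sigma>"
  have m: "0 < \<mu>" "\<mu> < 1" "\<mu> ^ T = \<sigma>" using s T by (auto simp: \<mu>_def)
  have pw: "a (q * T) \<le> \<sigma> ^ q * a 0" for q
  proof (induction q)
    case (Suc q)
    have "a (Suc q * T) \<le> \<sigma> * a (q * T)" using con'[of "q * T"] by (simp add: add.commute)
    also have "\<dots> \<le> \<sigma> * (\<sigma> ^ q * a 0)" using Suc s by simp
    finally show ?case by simp
  qed simp
  \<comment> \<open>Division by \<open>\<sigma>\<close> pays for the incomplete last period, and
    \<open>+ 1\<close> keeps the constant positive when \<open>a 0 = 0\<close>.\<close>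
  have "a t \<le> (a 0 / \<sigma> + 1) * \<mu> ^ t" for t
  proof -
    let ?q = "t div T"
    have "a t \<le> a (?q * T)"
      by (rule lift_Suc_antimono_le[of a, OF dec]) simp
    also have "\<dots> \<le> \<sigma> ^ ?q * a 0" by (rule pw)
    also have "\<dots> = a 0 / \<sigma> * (\<mu> ^ (T * ?q + T))"
      using s m by (simp add: power_add power_mult)
    also have "\<dots> \<le> a 0 / \<sigma> * \<mu> ^ t"
    proof (intro mult_left_mono power_decreasing)
      show "t \<le> T * ?q + T"
        by (metis T add.commute add_less_cancel_left less_imp_le mod_less_divisor mult_div_mod_eq)
    qed (use m s nn[of 0] in auto)
    also have "\<dots> \<le> (a 0 / \<sigma> + 1) * \<mu> ^ t" using m by (simp add: distrib_right)
    finally show ?thesis .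
  qed
  moreover have "0 < a 0 / \<sigma> + 1" using s nn[of 0] by (simp add: add_nonneg_pos)
  ultimately show ?thesis using that m by blast
qed

text \<open>The integral of the series is finite by monotone convergence, so the series converges
  almost everywhere and its terms tend to zero.\<close>

lemma AE_tendsto_zero_of_summable_integral:
  fixes f :: "nat \<Rightarrow> 'w \<Rightarrow> real"
  assumes int: "\<And>t. integrable M (f t)" and f0: "\<And>t \<omega>. 0 \<le> f t \<omega>"
    and sm: "summable (\<lambda>t. LINT \<omega>|M. f t \<omega>)"
  shows "AE \<omega> in M. (\<lambda>t. f t \<omega>) \<longlonglongrightarrow> 0"
proof -
  note [measurable] = borel_measurable_integrable[OF int]
  have "(\<integral>\<^sup>+\<omega>. (\<Sum>t. ennreal (f t \<omega>)) \<partial>M) = (\<Sum>t. ennreal (LINT \<omega>|M. f t \<omega>))"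
    using int f0 by (simp add: nn_integral_suminf nn_integral_eq_integral)
  also have "\<dots> \<noteq> \<infinity>"
    using sm f0 by (simp add: suminf_ennreal2 Bochner_Integration.integral_nonneg)
  finally have "AE \<omega> in M. (\<Sum>t. ennreal (f t \<omega>)) \<noteq> \<infinity>"
    by (intro nn_integral_noteq_infinite) auto
  then show ?thesis
  proof eventually_elim
    case (elim \<omega>)
    have "summable (\<lambda>t. f t \<omega>)"
      by (rule summable_suminf_not_top[OF f0])
        (use elim in \<open>simp only: infinity_ennreal_def not_False_eq_True\<close>)
    then show ?case by (rule summable_LIMSEQ_zero)
  qed
qed

text \<open>Countably many tolerances exhibit the convergence event as a countable combination of
  events, which makes it measurable.\<close>

lemma tendsto_iff_inverse_Suc:
  fixes f :: "nat \<Rightarrow> 'a::metric_space"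
  shows "f \<longlonglongrightarrow> l \<longleftrightarrow> (\<forall>m. \<exists>N. \<forall>n\<ge>N. dist (f n) l < inverse (real (Suc m)))"
proof
  assume "f \<longlonglongrightarrow> l"
  then show "\<forall>m. \<exists>N. \<forall>n\<ge>N. dist (f n) l < inverse (real (Suc m))"
    by (auto simp: lim_sequentially)
next
  assume *: "\<forall>m. \<exists>N. \<forall>n\<ge>N. dist (f n) l < inverse (real (Suc m))"
  show "f \<longlonglongrightarrow> l"
    unfolding lim_sequentially using * reals_Archimedean by (meson less_trans)
qed

section \<open>The random algorithm\<close>

locale random_consensus = prob_space M
  for M :: "'w measure" +
  fixes E :: "nat \<Rightarrow> 'w \<Rightarrow> 'n::{finite,linorder} set set"
    and W :: "nat \<Rightarrow> 'w \<Rightarrow> real^'n::{finite,linorder}^'n::{finite,linorder}"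
    and H :: "real^'m^'l::{finite,linorder}"
    and z :: "real^'l::{finite,linorder}"
    and ls :: "'n \<Rightarrow> nat"
    and x0 :: "real^'m^'n::{finite,linorder}"
    and x :: "nat \<Rightarrow> 'w \<Rightarrow> real^'m^'n::{finite,linorder}"
    and p :: real
  assumes blocks: "(\<Sum>i\<in>UNIV. ls i) = CARD('l)"
    and graphs: "random_graph_process M E"
    and mixing: "star_mixing M (edge_indicator E)"
    and weights: "mixing_weights M E W"
    and solvable: "\<exists>y. z = H *v y"
    and p_pos: "0 < p"
    and connected: "connected_edges (persistent_edges M E p)"
    and algorithm: "projection_consensus M ls H z W x0 x"
begin

abbreviation c :: "real^'m" where "c \<equiv> consensus_limit H z x0"

abbreviation past :: "nat \<Rightarrow> 'w measure" where
  "past t \<equiv> generated_algebra M (edge_indicator E) 0 (enat t)"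

definition V :: "nat \<Rightarrow> 'w \<Rightarrow> real" where "V t \<omega> = energy c (x t \<omega>)"

lemma V_nonneg: "0 \<le> V t \<omega>"
  by (simp add: V_def energy_nonneg)

lemma c_solution: "c \<in> solutions H z"
  using solvable by (intro consensus_limit_solution) (auto simp: solutions_def)

lemma c_local_solution: "c \<in> local_solutions ls H z i"
  using c_solution Inter_local_solutions[OF blocks] by blast

text \<open>Bundles what the existential constant of \<open>mixing_weights\<close> provides.
  Choosing it once, as \<open>\<eta>\<close>, gives all later lemmas the same constant for every
  time and sample point.\<close>

definition weight_bound :: "real \<Rightarrow> bool" where
  "weight_bound e \<longleftrightarrow> 0 < e \<and> (\<forall>\<omega>\<in>space M.
     consensus_run (local_solutions ls H z) (\<lambda>t. W t \<omega>) (\<lambda>t. x t \<omega>) e \<and>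
     (\<forall>t i j. {i, j} \<in> E t \<omega> \<longrightarrow> e \<le> W t \<omega> $ i $ j))"

definition \<eta> :: real where "\<eta> = (SOME e. weight_bound e)"

lemma weight_bound_ex: "\<exists>e. weight_bound e"
proof -
  from weights obtain e where e: "0 < e" "e < 1"
    and W: "\<And>t \<omega> i. \<omega> \<in> space M \<Longrightarrow> e \<le> W t \<omega> $ i $ i"
      "\<And>t \<omega> i j. \<omega> \<in> space M \<Longrightarrow> {i, j} \<in> E t \<omega> \<Longrightarrow> e \<le> W t \<omega> $ i $ j"
      "\<And>t \<omega> i j. \<omega> \<in> space M \<Longrightarrow> i \<noteq> j \<Longrightarrow> {i, j} \<notin> E t \<omega> \<Longrightarrow> W t \<omega> $ i $ j = 0"
    unfolding mixing_weights_def by (elim conjE exE) (rule that, auto)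
  have one: "W t \<omega> *v 1 = 1" "1 v* W t \<omega> = 1" if "\<omega> \<in> space M" for t \<omega>
    using weights that unfolding mixing_weights_def by (elim conjE; simp)+
  have nonneg: "0 \<le> W t \<omega> $ i $ j" if "\<omega> \<in> space M" for t \<omega> i j
  proof -
    consider "i = j" | "{i, j} \<in> E t \<omega>" | "i \<noteq> j" "{i, j} \<notin> E t \<omega>" by blast
    then show ?thesis
    proof cases
      case 1 then show ?thesis using W(1)[OF that, of t i] e(1) by simp
    next
      case 2 then show ?thesis using W(2)[OF that 2] e(1) by simp
    next
      case 3 then show ?thesis using W(3)[OF that 3] by simp
    qed
  qed
  have step: "x (Suc t) \<omega> $ i =
      closest_point (local_solutions ls H z i) (\<Sum>j\<in>UNIV. W t \<omega> $ i $ j *\<^sub>R x t \<omega> $ j)"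
    if "\<omega> \<in> space M" for t \<omega> i
    using algorithm that by (simp add: projection_consensus_def)
  have "consensus_run (local_solutions ls H z) (\<lambda>t. W t \<omega>) (\<lambda>t. x t \<omega>) e"
    if \<omega>: "\<omega> \<in> space M" for \<omega>
  proof
    show "(\<Sum>j\<in>UNIV. W t \<omega> $ i $ j) = 1" for t i
      using arg_cong[OF one(1)[OF \<omega>, of t], of "\<lambda>v. v $ i"] by (simp add: matrix_vector_mult_def)
    show "(\<Sum>i\<in>UNIV. W t \<omega> $ i $ j) = 1" for t j
      using arg_cong[OF one(2)[OF \<omega>, of t], of "\<lambda>v. v $ j"] by (simp add: vector_matrix_mult_def)
    show "0 < e" "e \<le> 1" using e by auto
    show "affine (local_solutions ls H z i)" "closed (local_solutions ls H z i)" for i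
      by (rule affine_local_solutions closed_local_solutions)+
    show "0 \<le> W t \<omega> $ i $ j" "e \<le> W t \<omega> $ i $ i" for t i j
      by (rule nonneg[OF \<omega>] W(1)[OF \<omega>])+
    show "x (Suc t) \<omega> $ i =
        closest_point (local_solutions ls H z i) (\<Sum>j\<in>UNIV. W t \<omega> $ i $ j *\<^sub>R x t \<omega> $ j)" for t i
      by (rule step[OF \<omega>])
  qed
  then have "weight_bound e" unfolding weight_bound_def using e(1) W(2) by simp
  then show ?thesis ..
qed

lemma weight_bound: "weight_bound \<eta>"
  unfolding \<eta>_def by (rule someI_ex[OF weight_bound_ex])

lemma eta_pos: "0 < \<eta>"
  using weight_bound by (simp add: weight_bound_def)

lemma run:
  assumes "\<omega> \<in> space M"
  shows "consensus_run (local_solutions ls H z) (\<lambda>t. W t \<omega>) (\<lambda>t. x t \<omega>) \<eta>"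
  using weight_bound assms unfolding weight_bound_def by simp

lemma edge_weight:
  assumes "\<omega> \<in> space M" "{i, j} \<in> E t \<omega>"
  shows "\<eta> \<le> W t \<omega> $ i $ j"
  using weight_bound assms unfolding weight_bound_def by simp

lemma V_antimono:
  assumes "\<omega> \<in> space M" "s \<le> t"
  shows "V t \<omega> \<le> V s \<omega>"
proof -
  show ?thesis unfolding V_def
    by (rule consensus_run.energy_antimono[OF run[OF assms(1)] c_local_solution assms(2)])
qed

section \<open>Adaptedness and integrability of the states\<close>

lemma subalgebra_past: "subalgebra M (past t)"
  using graphs by (intro subalgebra_generated_algebra) (simp add: random_graph_process_def)

text \<open>The state at time \<open>t\<close> is built from weights at earlier times. The index
  \<open>t\<close> of \<open>past\<close> is generous by one, so that the constant initial state
  fits the same pattern.\<close>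

lemma measurable_state_past: "(\<lambda>\<omega>. x t \<omega> $ i) \<in> borel_measurable (past t)"
proof (induction t arbitrary: i)
  case 0
  have "(\<lambda>\<omega>. x0 $ i) \<in> borel_measurable (past 0)" by simp
  also have "?this \<longleftrightarrow> ?case"
    using algorithm by (intro measurable_cong) (simp add: projection_consensus_def)
  finally show ?case .
next
  case (Suc t)
  have sub: "f \<in> borel_measurable (past (Suc t))"
    if "f \<in> borel_measurable (generated_algebra M (edge_indicator E) l (enat t))"
    for l and f :: "'w \<Rightarrow> 'b::topological_space"
  proof (rule measurable_from_subalg[OF _ that])
    show "subalgebra (past (Suc t)) (generated_algebra M (edge_indicator E) l (enat t))"
      unfolding subalgebra_def
      using sets_generated_algebra_mono[of 0 l "enat t" "enat (Suc t)"] by auto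
  qed
  have [measurable]: "W t \<in> borel_measurable (past (Suc t))"
    using weights by (intro sub) (auto simp: mixing_weights_def)
  have [measurable]: "(\<lambda>\<omega>. x t \<omega> $ j) \<in> borel_measurable (past (Suc t))" for j
    by (rule sub[OF Suc.IH])
  \<comment> \<open>Projection onto a nonempty closed convex set is continuous; \<open>c\<close>
    witnesses nonemptiness.\<close>
  have [measurable]: "closest_point (local_solutions ls H z i) \<in> borel_measurable borel"
    using c_local_solution
    by (intro borel_measurable_continuous_onI continuous_on_closest_point affine_imp_convex
        affine_local_solutions closed_local_solutions) auto
  have [measurable]: "(\<lambda>\<omega>. W t \<omega> $ i $ j) \<in> borel_measurable (past (Suc t))" for j
    by (intro borel_measurable_continuous_on[of "\<lambda>A. A $ i $ j"] continuous_intros) measurable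
  have "(\<lambda>\<omega>. closest_point (local_solutions ls H z i) (\<Sum>j\<in>UNIV. W t \<omega> $ i $ j *\<^sub>R x t \<omega> $ j))
      \<in> borel_measurable (past (Suc t))"
    by measurable
  also have "?this \<longleftrightarrow> ?case"
    using algorithm by (intro measurable_cong) (simp add: projection_consensus_def)
  finally show ?case .
qed

lemma measurable_state [measurable]: "(\<lambda>\<omega>. x t \<omega> $ i) \<in> borel_measurable M"
  by (rule measurable_from_subalg[OF subalgebra_past measurable_state_past])

text \<open>Pathwise monotonicity bounds the energy by its initial value, a constant because the
  initial states are deterministic.\<close>

lemma integrable_V: "integrable M (V t)"
proof (rule integrable_const_bound)
  show "AE \<omega> in M. norm (V t \<omega>) \<le> energy c x0"
  proof (rule AE_I2)
    fix \<omega> assume \<omega>: "\<omega> \<in> space M"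
    have "V t \<omega> \<le> V 0 \<omega>" by (rule V_antimono[OF \<omega>]) simp
    also have "V 0 \<omega> = energy c x0"
      using algorithm \<omega> by (simp add: V_def projection_consensus_def)
    finally show "norm (V t \<omega>) \<le> energy c x0" using V_nonneg[of t \<omega>] by simp
  qed
  show "V t \<in> borel_measurable M" unfolding V_def energy_def by measurable
qed

text \<open>
  The edge \<open>{i, j}\<close> at time \<open>t + k\<close> is nearly independent of the state at time \<open>t\<close>, so its
  indicator costs only a factor \<open>p / 2\<close> in expectation. Hence no window in which the union
  graph is connected is ever needed.
\<close>

lemma expected_disagreement:
  obtains C k where "0 \<le> C"
    "\<And>t i j. {i, j} \<in> persistent_edges M E p \<Longrightarrow>
      integrable M (\<lambda>\<omega>. (norm (x t \<omega> $ i - x t \<omega> $ j))\<^sup>2) \<and>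
      (LINT \<omega>|M. (norm (x t \<omega> $ i - x t \<omega> $ j))\<^sup>2)
        \<le> C * ((LINT \<omega>|M. V t \<omega>) - (LINT \<omega>|M. V (t + Suc k) \<omega>))"
proof -
  obtain lam :: "nat \<Rightarrow> real" where lam: "lam \<longlonglongrightarrow> 0"
    and mix: "\<And>m s A B. A \<in> sets (past m) \<Longrightarrow>
      B \<in> sets (generated_algebra M (edge_indicator E) (m + s) \<infinity>) \<Longrightarrow>
      \<bar>measure M (A \<inter> B) - measure M A * measure M B\<bar> \<le> lam s * measure M A * measure M B"
    using mixing unfolding star_mixing_def by blast
  \<comment> \<open>This gap depends on the mixing rate alone, so one window length serves all times
    and all edges.\<close>
  obtain k where k: "lam k < 1 / 2"
    using order_tendstoD(2)[OF lam, of "1/2"] by (auto simp: eventually_sequentially)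
  \<comment> \<open>The constant of \<open>norm_edge_diff\<close>; the factor \<open>2 / p\<close>
    below undoes the \<open>p / 2\<close> lost to mixing.\<close>
  define K where "K = (4 * real (Suc k))\<^sup>2 / \<eta>"
  show ?thesis
  proof (rule that[of "2 / p * K" k], goal_cases)
    case 1
    show ?case using eta_pos p_pos by (simp add: K_def)
  next
    case (2 t i j)
    define B where "B = {\<omega> \<in> space M. {i, j} \<in> E (t + k) \<omega>}"
    define f where "f \<omega> = (norm (x t \<omega> $ i - x t \<omega> $ j))\<^sup>2" for \<omega>
    have pB: "p \<le> measure M B"
    proof -
      obtain a b where ab: "{i, j} = {a, b}" "\<forall>t. p \<le> \<P>(\<omega> in M. {a, b} \<in> E t \<omega>)"
        using 2 unfolding persistent_edges_def by blast
      show ?thesis unfolding B_def ab(1) using ab(2) by blast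
    qed
    have Bv: "B = edge_indicator E (t + k) -` {a. a $ i $ j = 1} \<inter> space M"
      by (auto simp: B_def edge_indicator_def)
    have "closed {a :: real^'n::{finite,linorder}^'n::{finite,linorder}. a $ i $ j = 1}"
      by (intro closed_Collect_eq continuous_intros)
    then have B: "B \<in> sets (generated_algebra M (edge_indicator E) (t + k) \<infinity>)"
      unfolding Bv by (intro vimage_generated_algebra) auto
    then have BM: "B \<in> sets M"
      using subalgebra_generated_algebra[of "edge_indicator E" M "t + k" \<infinity>] graphs
      by (auto simp: subalgebra_def random_graph_process_def)
    \<comment> \<open>Mixing used one-sidedly: given any past event of positive probability, the
      edge keeps conditional probability at least \<open>p / 2\<close>.\<close>
    have low: "p / 2 * measure M A \<le> measure M (A \<inter> B)" if A: "A \<in> sets (past t)" for A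
    proof -
      have "p / 2 * measure M A \<le> 1 / 2 * (measure M A * measure M B)"
        using mult_left_mono[OF pB, of "measure M A"] by (simp add: mult.commute)
      also have "\<dots> \<le> (1 - lam k) * (measure M A * measure M B)"
        using k by (intro mult_right_mono) auto
      also have "\<dots> = measure M A * measure M B - lam k * measure M A * measure M B"
        by (simp add: algebra_simps)
      also have "\<dots> \<le> measure M (A \<inter> B)" using mix[OF A B] by linarith
      finally show ?thesis .
    qed
    have fm: "f \<in> borel_measurable (past t)"
    proof -
      note [measurable] = measurable_state_past[of t]
      show ?thesis unfolding f_def by measurable
    qed
    have f0: "0 \<le> f \<omega>" for \<omega> by (simp add: f_def)
    \<comment> \<open>A crude domination that yields integrability of \<open>f\<close>.\<close>
    have fV: "f \<omega> \<le> 4 * V t \<omega>" for \<omega>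
    proof -
      have "(norm (x t \<omega> $ l - c))\<^sup>2 \<le> V t \<omega>" for l
        unfolding V_def energy_def by (rule member_le_sum) auto
      then have n: "norm (x t \<omega> $ l - c) \<le> sqrt (V t \<omega>)" for l by (rule real_le_rsqrt)
      have "norm (x t \<omega> $ i - x t \<omega> $ j) \<le> 2 * sqrt (V t \<omega>)"
        using n[of i] n[of j] norm_triangle_ineq4[of "x t \<omega> $ i - c" "x t \<omega> $ j - c"] by simp
      then have "f \<omega> \<le> (2 * sqrt (V t \<omega>))\<^sup>2" unfolding f_def by (intro power_mono) auto
      then show ?thesis using V_nonneg[of t \<omega>] by (simp add: power_mult_distrib)
    qed
    have fi: "integrable M f"
    proof (rule Bochner_Integration.integrable_bound[OF integrable_mult_right[OF integrable_V, of 4]])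
      show "f \<in> borel_measurable M" by (rule measurable_from_subalg[OF subalgebra_past fm])
      show "AE \<omega> in M. norm (f \<omega>) \<le> norm (4 * V t \<omega>)"
        using fV f0 V_nonneg by (intro AE_I2) auto
    qed
    \<comment> \<open>On \<open>B\<close> this is the pathwise edge bound; off \<open>B\<close> the
      left side is zero and the energy drop is nonnegative.\<close>
    have fB: "f \<omega> * indicator B \<omega> \<le> K * (V t \<omega> - V (t + Suc k) \<omega>)" if \<omega>: "\<omega> \<in> space M" for \<omega>
    proof (cases "\<omega> \<in> B")
      case True
      have "f \<omega> \<le> (4 * real (Suc k))\<^sup>2 * ((V t \<omega> - V (t + Suc k) \<omega>) / \<eta>)"
        unfolding f_def V_def
        by (rule consensus_run.norm_edge_diff[OF run[OF \<omega>] c_local_solution edge_weight[OF \<omega>]])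
          (use True in \<open>simp add: B_def\<close>)
      then show ?thesis using True by (simp add: K_def)
    next
      case False
      have "0 \<le> K" using eta_pos by (simp add: K_def)
      then show ?thesis using False V_antimono[OF \<omega>, of t "t + Suc k"] by simp
    qed
    have "p / 2 * (LINT \<omega>|M. f \<omega>) \<le> (LINT \<omega>|M. f \<omega> * indicator B \<omega>)"
      using p_pos
      by (intro integral_indicator_lower[OF finite_measure_axioms subalgebra_past BM _ low fm f0 fi]) auto
    also have "\<dots> \<le> (LINT \<omega>|M. K * (V t \<omega> - V (t + Suc k) \<omega>))"
      using fB by (intro integral_mono integrable_real_mult_indicator[OF BM fi] integrable_mult_right
          Bochner_Integration.integrable_diff integrable_V) auto
    also have "\<dots> = K * ((LINT \<omega>|M. V t \<omega>) - (LINT \<omega>|M. V (t + Suc k) \<omega>))"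
      by (simp add: integrable_V)
    finally have "(LINT \<omega>|M. f \<omega>)
        \<le> 2 / p * K * ((LINT \<omega>|M. V t \<omega>) - (LINT \<omega>|M. V (t + Suc k) \<omega>))"
      using p_pos by (simp add: field_simps)
    then show ?case using fi unfolding f_def by blast
  qed
qed

text \<open>The next state of a node satisfies its local equations, so in its rows the residual is
  \<open>H\<close> applied to a one-step move, which the energy drop controls. The bound is pathwise
  and holds for every window length.\<close>

lemma residual_bound:
  obtains C where "0 \<le> C"
    "\<And>t k \<omega>. \<omega> \<in> space M \<Longrightarrow>
      (\<Sum>i\<in>UNIV. \<Sum>l\<in>row_block ls i. ((H *v (x t \<omega> $ i - c)) $ l)\<^sup>2)
        \<le> C * (V t \<omega> - V (t + Suc k) \<omega>)"
proof -
  define b where "b = onorm ((*v) H)"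
  define C where "C = real CARD('n) * (b\<^sup>2 * 4 / \<eta>)"
  show ?thesis
  proof (rule that[of C], goal_cases)
    case 1
    show ?case using eta_pos by (simp add: C_def)
  next
    case (2 t k \<omega>)
    have "(\<Sum>l\<in>row_block ls i. ((H *v (x t \<omega> $ i - c)) $ l)\<^sup>2)
        \<le> b\<^sup>2 * 4 / \<eta> * (V t \<omega> - V (t + Suc k) \<omega>)" for i
    proof -
      let ?d = "x t \<omega> $ i - x (Suc t) \<omega> $ i"
      have "x (Suc t) \<omega> $ i \<in> local_solutions ls H z i"
        using consensus_run.step[OF run[OF 2], of t i] c_local_solution
          closest_point_in_set[OF closed_local_solutions] by (metis empty_iff)
      then have "(H *v (x t \<omega> $ i - c)) $ l = (H *v ?d) $ l" if "l \<in> row_block ls i" for l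
        using that c_local_solution[of i]
        by (simp add: local_solutions_def matrix_vector_mult_diff_distrib)
      then have "(\<Sum>l\<in>row_block ls i. ((H *v (x t \<omega> $ i - c)) $ l)\<^sup>2)
          = (\<Sum>l\<in>row_block ls i. ((H *v ?d) $ l)\<^sup>2)" by simp
      also have "\<dots> \<le> (\<Sum>l\<in>UNIV. ((H *v ?d) $ l)\<^sup>2)" by (rule sum_mono2) auto
      also have "\<dots> = (norm (H *v ?d))\<^sup>2" by (simp add: norm_vec_def L2_set_def sum_nonneg)
      also have "\<dots> \<le> (b * norm ?d)\<^sup>2"
        unfolding b_def by (intro power_mono onorm) auto
      also have "\<dots> = b\<^sup>2 * (norm ?d)\<^sup>2" by (simp add: power_mult_distrib)
      also have "\<dots> \<le> b\<^sup>2 * (4 * ((V t \<omega> - V (t + Suc k) \<omega>) / \<eta>))"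
        unfolding V_def
        by (intro mult_left_mono consensus_run.norm_residual[OF run[OF 2]] c_local_solution) auto
      finally show ?thesis by (simp add: field_simps)
    qed
    then have "(\<Sum>i\<in>UNIV. \<Sum>l\<in>row_block ls i. ((H *v (x t \<omega> $ i - c)) $ l)\<^sup>2)
        \<le> (\<Sum>i\<in>(UNIV::'n set). b\<^sup>2 * 4 / \<eta> * (V t \<omega> - V (t + Suc k) \<omega>))"
      by (intro sum_mono) auto
    then show ?case by (simp add: C_def)
  qed
qed

text \<open>For \<open>u\<close> in the kernel of \<open>H\<close>, \<open>c + u\<close> is again a
  solution. The conserved inner product and its initial value then show that the deviations sum to a
  vector orthogonal to \<open>u\<close>, so coercivity of the form applies at every time.\<close>

lemma defect_V_lower:
  defines "F \<equiv> {(i, j). {i, j} \<in> persistent_edges M E p}"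
  obtains \<kappa> where "0 < \<kappa>"
    "\<And>t \<omega>. \<omega> \<in> space M \<Longrightarrow> \<kappa> * V t \<omega> \<le> defect F (row_block ls) H (x t \<omega> - (\<chi> i. c))"
proof -
  obtain \<kappa> where \<kappa>: "0 < \<kappa>"
    and d: "\<And>v :: real^'m^'n::{finite,linorder}. (\<And>u. H *v u = 0 \<Longrightarrow> (\<Sum>i\<in>UNIV. v $ i \<bullet> u) = 0) \<Longrightarrow>
      \<kappa> * (norm v)\<^sup>2 \<le> defect F (row_block ls) H v"
  proof (rule defect_lower_bound[of F "row_block ls" H])
    show "(i, j) \<in> F\<^sup>*" for i j
      using connected by (simp add: F_def connected_edges_def)
    show "\<exists>i. k \<in> row_block ls i" for k :: 'l
      using row_block_cover[OF blocks] by blast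
  qed blast
  have "\<kappa> * V t \<omega> \<le> defect F (row_block ls) H (x t \<omega> - (\<chi> i. c))" if \<omega>: "\<omega> \<in> space M" for t \<omega>
    unfolding V_def energy_eq_norm
  proof (rule d)
    fix u assume u: "H *v u = 0"
    have y: "c + u \<in> solutions H z"
      using c_solution u by (simp add: solutions_def matrix_vector_right_distrib)
    then have yl: "c + u \<in> local_solutions ls H z i" for i
      using Inter_local_solutions[OF blocks] by blast
    have "(\<Sum>i\<in>UNIV. x t \<omega> $ i \<bullet> u) = (\<Sum>i\<in>UNIV. x 0 \<omega> $ i \<bullet> u)"
      using consensus_run.sum_inner_invariant[OF run[OF \<omega>] c_local_solution yl, of t] by simp
    moreover have "x 0 \<omega> = x0" using algorithm \<omega> by (simp add: projection_consensus_def)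
    moreover have "(\<Sum>i\<in>UNIV. (x0 $ i - c) \<bullet> u) = 0"
      using consensus_limit_orthogonal[OF y, of x0] by simp
    ultimately show "(\<Sum>i\<in>UNIV. (x t \<omega> - (\<chi> i. c)) $ i \<bullet> u) = 0"
      by (simp add: inner_diff_left sum_subtractf)
  qed
  then show ?thesis using that \<kappa> by blast
qed

section \<open>Contraction of the expected energy and convergence\<close>

lemma expected_V_antimono:
  assumes "s \<le> t"
  shows "(LINT \<omega>|M. V t \<omega>) \<le> (LINT \<omega>|M. V s \<omega>)"
  using assms by (intro integral_mono integrable_V V_antimono)

lemma expected_V_contraction:
  obtains \<rho> k where "\<rho> < 1"
    "\<And>t. (LINT \<omega>|M. V (t + Suc k) \<omega>) \<le> \<rho> * (LINT \<omega>|M. V t \<omega>)"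
proof -
  define F where "F = {(i, j). {i, j} \<in> persistent_edges M E p}"
  obtain \<kappa> where \<kappa>: "0 < \<kappa>" and low:
    "\<And>t \<omega>. \<omega> \<in> space M \<Longrightarrow> \<kappa> * V t \<omega> \<le> defect F (row_block ls) H (x t \<omega> - (\<chi> i. c))"
    unfolding F_def using defect_V_lower by blast
  obtain C k where C: "0 \<le> C" and edge:
    "\<And>t i j. {i, j} \<in> persistent_edges M E p \<Longrightarrow>
      integrable M (\<lambda>\<omega>. (norm (x t \<omega> $ i - x t \<omega> $ j))\<^sup>2) \<and>
      (LINT \<omega>|M. (norm (x t \<omega> $ i - x t \<omega> $ j))\<^sup>2)
        \<le> C * ((LINT \<omega>|M. V t \<omega>) - (LINT \<omega>|M. V (t + Suc k) \<omega>))"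
    using expected_disagreement by blast
  obtain R where R: "0 \<le> R" and res:
    "\<And>t k \<omega>. \<omega> \<in> space M \<Longrightarrow>
      (\<Sum>i\<in>UNIV. \<Sum>l\<in>row_block ls i. ((H *v (x t \<omega> $ i - c)) $ l)\<^sup>2)
        \<le> R * (V t \<omega> - V (t + Suc k) \<omega>)"
    using residual_bound by blast
  \<comment> \<open>Cost of the defect in units of the expected energy drop: \<open>C\<close> for
    each ordered persistent pair, \<open>R\<close> for the residuals, and \<open>1\<close> to make
    \<open>L\<close> positive.\<close>
  define L where "L = real (card F) * C + R + 1"
  have L: "0 < L" using C R by (simp add: L_def add_nonneg_pos)
  have "(LINT \<omega>|M. V (t + Suc k) \<omega>) \<le> (1 - \<kappa> / L) * (LINT \<omega>|M. V t \<omega>)" for t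
  proof -
    let ?a = "LINT \<omega>|M. V t \<omega>" and ?b = "LINT \<omega>|M. V (t + Suc k) \<omega>"
    let ?f = "\<lambda>q \<omega>. (norm (x t \<omega> $ fst q - x t \<omega> $ snd q))\<^sup>2"
    have fi: "integrable M (?f q)" "(LINT \<omega>|M. ?f q \<omega>) \<le> C * (?a - ?b)" if "q \<in> F" for q
      using edge[of "fst q" "snd q" t] that by (auto simp: F_def case_prod_beta)
    have si: "integrable M (\<lambda>\<omega>. \<Sum>q\<in>F. ?f q \<omega>)"
      by (rule Bochner_Integration.integrable_sum) (rule fi(1))
    have "\<kappa> * ?a = (LINT \<omega>|M. \<kappa> * V t \<omega>)" by simp
    \<comment> \<open>Residuals are traded for the energy drop pathwise; disagreements stay, since
      their bound holds only in expectation.\<close>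
    also have "\<dots> \<le> (LINT \<omega>|M. (\<Sum>q\<in>F. ?f q \<omega>) + R * (V t \<omega> - V (t + Suc k) \<omega>))"
    proof (intro integral_mono integrable_mult_right Bochner_Integration.integrable_add
        Bochner_Integration.integrable_diff integrable_V si)
      fix \<omega> assume \<omega>: "\<omega> \<in> space M"
      show "\<kappa> * V t \<omega> \<le> (\<Sum>q\<in>F. ?f q \<omega>) + R * (V t \<omega> - V (t + Suc k) \<omega>)"
        using low[OF \<omega>, of t] res[OF \<omega>, of t k] by (simp add: defect_def case_prod_beta)
    qed
    also have "\<dots> = (\<Sum>q\<in>F. LINT \<omega>|M. ?f q \<omega>) + R * (?a - ?b)"
      using si fi(1) by (simp add: integrable_V Bochner_Integration.integral_sum)
    also have "\<dots> \<le> (\<Sum>q\<in>F. C * (?a - ?b)) + R * (?a - ?b)"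
      by (intro add_right_mono sum_mono fi(2))
    also have "\<dots> \<le> L * (?a - ?b)"
      using expected_V_antimono[of t "t + Suc k"] by (simp add: L_def algebra_simps)
    \<comment> \<open>\<open>\<kappa> * ?a \<le> L * (?a - ?b)\<close> rearranges to the
      contraction.\<close>
    finally show ?thesis using L by (simp add: field_simps)
  qed
  moreover have "1 - \<kappa> / L < 1" using \<kappa> L by simp
  ultimately show ?thesis using that by blast
qed

lemma expected_V_exponential:
  obtains \<mu> C where "0 < \<mu>" "\<mu> < 1" "0 < C" "\<And>t. (LINT \<omega>|M. V t \<omega>) \<le> C * \<mu> ^ t"
proof -
  obtain \<rho> k where \<rho>: "\<rho> < 1"
    "\<And>t. (LINT \<omega>|M. V (t + Suc k) \<omega>) \<le> \<rho> * (LINT \<omega>|M. V t \<omega>)"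
    using expected_V_contraction by blast
  show ?thesis
    by (rule periodic_contraction_exponential[of "\<lambda>t. LINT \<omega>|M. V t \<omega>" "Suc k" \<rho>])
      (use \<rho> that in \<open>auto intro: V_nonneg expected_V_antimono Bochner_Integration.integral_nonneg\<close>)
qed

lemma AE_state_tendsto: "AE \<omega> in M. (\<lambda>t. x t \<omega> $ i) \<longlonglongrightarrow> c"
proof -
  obtain \<mu> C where \<mu>: "0 < \<mu>" "\<mu> < 1" "\<And>t. (LINT \<omega>|M. V t \<omega>) \<le> C * \<mu> ^ t"
    using expected_V_exponential by blast
  have "summable (\<lambda>t. LINT \<omega>|M. V t \<omega>)"
  proof (rule summable_comparison_test')
    show "summable (\<lambda>t. C * \<mu> ^ t)"
      using \<mu> by (intro summable_mult summable_geometric) auto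
    show "norm (LINT \<omega>|M. V t \<omega>) \<le> C * \<mu> ^ t" for t
      using \<mu>(3)[of t] Bochner_Integration.integral_nonneg[of M "V t"] V_nonneg by simp
  qed
  then have "AE \<omega> in M. (\<lambda>t. V t \<omega>) \<longlonglongrightarrow> 0"
    by (intro AE_tendsto_zero_of_summable_integral integrable_V V_nonneg)
  then show ?thesis
  proof eventually_elim
    case (elim \<omega>)
    have "(\<lambda>t. norm (x t \<omega> $ i - c)) \<longlonglongrightarrow> 0"
    proof (rule tendsto_sandwich[OF _ _ tendsto_const])
      have "(norm (x t \<omega> $ i - c))\<^sup>2 \<le> V t \<omega>" for t
        unfolding V_def energy_def by (rule member_le_sum) auto
      then show "\<forall>\<^sub>F t in sequentially. norm (x t \<omega> $ i - c) \<le> sqrt (V t \<omega>)"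
        by (intro always_eventually allI real_le_rsqrt)
      show "(\<lambda>t. sqrt (V t \<omega>)) \<longlonglongrightarrow> 0" using tendsto_real_sqrt[OF elim] by simp
    qed auto
    then show ?case by (simp add: tendsto_norm_zero_iff LIM_zero_iff)
  qed
qed

text \<open>Passing from almost everywhere to probability one calls for a measurable event, supplied
  by the countable form of convergence.\<close>

lemma prob_state_tendsto: "\<P>(\<omega> in M. (\<lambda>t. x t \<omega> $ i) \<longlonglongrightarrow> c) = 1"
proof -
  have "{\<omega> \<in> space M. (\<lambda>t. x t \<omega> $ i) \<longlonglongrightarrow> c} \<in> sets M"
    unfolding tendsto_iff_inverse_Suc by measurable
  then show ?thesis using AE_state_tendsto by (subst prob_Collect_eq_1) auto
qed

end

text \<open>The integral of a nonintegrable function is \<open>0\<close> by convention, so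
  integrability is claimed together with the error bound to give it its intended meaning.\<close>

theorem theorem1:
  fixes M :: "'w measure"
    and E :: "nat \<Rightarrow> 'w \<Rightarrow> 'n::{finite,linorder} set set"
    and W :: "nat \<Rightarrow> 'w \<Rightarrow> real^'n::{finite,linorder}^'n::{finite,linorder}"
    and H :: "real^'m^'l::{finite,linorder}"
    and z :: "real^'l::{finite,linorder}"
    and ls :: "'n \<Rightarrow> nat"
    and x0 :: "real^'m^'n::{finite,linorder}"
    and x :: "nat \<Rightarrow> 'w \<Rightarrow> real^'m^'n::{finite,linorder}"
    and p :: real
  assumes "prob_space M"
    and "(\<Sum>i\<in>UNIV. ls i) = CARD('l)"
    and "random_graph_process M E"
    and "star_mixing M (edge_indicator E)"
    and "mixing_weights M E W"
    and "\<exists>y. z = H *v y"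
    and "0 < p" and "p < 1"
    and "connected_edges (persistent_edges M E p)"
    and "projection_consensus M ls H z W x0 x"
  shows "(\<forall>i. \<P>(\<omega> in M. (\<lambda>t. x t \<omega> $ i) \<longlonglongrightarrow> consensus_limit H z x0) = 1) \<and>
    (\<exists>\<mu> c. 0 < \<mu> \<and> \<mu> < 1 \<and> c > 0 \<and>
      (\<forall>t. integrable M (\<lambda>\<omega>. \<Sum>i\<in>UNIV. (norm (x t \<omega> $ i - consensus_limit H z x0))\<^sup>2) \<and>
           (LINT \<omega>|M. (\<Sum>i\<in>UNIV. (norm (x t \<omega> $ i - consensus_limit H z x0))\<^sup>2)) \<le> c * \<mu> ^ t))"
proof -
  interpret random_consensus M E W H z ls x0 x p
    using assms by (intro random_consensus.intro random_consensus_axioms.intro)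
  obtain \<mu> C where "0 < \<mu>" "\<mu> < 1" "0 < C" "\<And>t. (LINT \<omega>|M. V t \<omega>) \<le> C * \<mu> ^ t"
    using expected_V_exponential by blast
  then show ?thesis
    using prob_state_tendsto integrable_V unfolding V_def energy_def by blast
qed

end
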